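(* Almost every sparse paving matroid has a minor isomorphic to $\mathcal{W}^3$ or to $M(K_4)$; that is, if $s(n)$ is the number of sparse paving matroids on ground set $[n]$ and $s_{\mathcal{X}}(n)$ is the number of those having no minor isomorphic to $\mathcal{W}^3$ or $M(K_4)$, then $s_{\mathcal{X}}(n)=o(s(n))$ as $n\to\infty$.
   Context: A matroid is sparse paving if every nonspanning circuit is also a hyperplane. $\mathcal{W}^3$ is the rank-3 whirl: the rank-3 matroid on $\{a,b,c,d,e,f\}$ whose only dependent 3-sets are $\{a,b,c\},\{c,d,e\},\{e,f,a\}$. $M(K_4)$ is the cycle matroid of $K_4$; equivalently the rank-3 matroid on $\{a,b,c,d,e,f\}$ whose only dependent 3-sets are $\{a,b,c\},\{c,d,e\},\{e,f,a\},\{b,d,f\}$. Matroids are counted as labelled matroids on $[n]$. *)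

theory Defs
  imports Main "HOL-Library.Landau_Symbols"
begin

definition matroid :: "'a set \<Rightarrow> 'a set set \<Rightarrow> bool" where
  "matroid E Ind \<longleftrightarrow> finite E \<and> Ind \<subseteq> Pow E \<and> {} \<in> Ind
     \<and> (\<forall>X Y. Y \<in> Ind \<and> X \<subseteq> Y \<longrightarrow> X \<in> Ind)
     \<and> (\<forall>X Y. X \<in> Ind \<and> Y \<in> Ind \<and> card X < card Y \<longrightarrow> (\<exists>y\<in>Y - X. insert y X \<in> Ind))"

definition mrank :: "'a set set \<Rightarrow> 'a set \<Rightarrow> nat" where
  "mrank Ind X = Max (card ` {Y. Y \<subseteq> X \<and> Y \<in> Ind})"

definition circuit :: "'a set \<Rightarrow> 'a set set \<Rightarrow> 'a set \<Rightarrow> bool" where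
  "circuit E Ind C \<longleftrightarrow> C \<subseteq> E \<and> C \<notin> Ind \<and> (\<forall>x\<in>C. C - {x} \<in> Ind)"

definition flat :: "'a set \<Rightarrow> 'a set set \<Rightarrow> 'a set \<Rightarrow> bool" where
  "flat E Ind X \<longleftrightarrow> X \<subseteq> E \<and> (\<forall>e\<in>E - X. mrank Ind (insert e X) > mrank Ind X)"

definition hyperplane :: "'a set \<Rightarrow> 'a set set \<Rightarrow> 'a set \<Rightarrow> bool" where
  "hyperplane E Ind X \<longleftrightarrow> flat E Ind X \<and> mrank Ind X + 1 = mrank Ind E"

definition sparse_paving :: "'a set \<Rightarrow> 'a set set \<Rightarrow> bool" where
  "sparse_paving E Ind \<longleftrightarrow>
     (\<forall>C. circuit E Ind C \<and> mrank Ind C < mrank Ind E \<longrightarrow> hyperplane E Ind C)"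

definition minor_of :: "'a set \<Rightarrow> 'a set set \<Rightarrow> 'a set \<Rightarrow> 'a set set \<Rightarrow> bool" where
  "minor_of E' Ind' E Ind \<longleftrightarrow>
     (\<exists>C D. C \<subseteq> E \<and> D \<subseteq> E \<and> C \<inter> D = {} \<and> E' = E - C - D \<and>
        Ind' = {I. I \<subseteq> E - C - D \<and> mrank Ind (I \<union> C) = card I + mrank Ind C})"

definition matroid_iso :: "'a set \<Rightarrow> 'a set set \<Rightarrow> 'b set \<Rightarrow> 'b set set \<Rightarrow> bool" where
  "matroid_iso E1 I1 E2 I2 \<longleftrightarrow>
     (\<exists>f. bij_betw f E1 E2 \<and> (\<forall>X. X \<subseteq> E1 \<longrightarrow> (X \<in> I1 \<longleftrightarrow> f ` X \<in> I2)))"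

definition has_minor_iso :: "'a set \<Rightarrow> 'a set set \<Rightarrow> 'b set \<Rightarrow> 'b set set \<Rightarrow> bool" where
  "has_minor_iso E Ind F J \<longleftrightarrow> (\<exists>E' Ind'. minor_of E' Ind' E Ind \<and> matroid_iso E' Ind' F J)"

text \<open>Ground set {a,b,c,d,e,f} encoded as 0,1,2,3,4,5.\<close>
definition six :: "nat set" where "six = {0..5}"

definition whirl3 :: "nat set set" where
  "whirl3 = {X. X \<subseteq> six \<and> card X \<le> 3 \<and> X \<notin> {{0,1,2},{2,3,4},{4,5,0}}}"

definition MK4 :: "nat set set" where
  "MK4 = {X. X \<subseteq> six \<and> card X \<le> 3 \<and> X \<notin> {{0,1,2},{2,3,4},{4,5,0},{1,3,5}}}"

definition s :: "nat \<Rightarrow> nat" where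
  "s n = card {Ind. matroid {1..n} Ind \<and> sparse_paving {1..n} Ind}"

definition sX :: "nat \<Rightarrow> nat" where
  "sX n = card {Ind. matroid {1..n} Ind \<and> sparse_paving {1..n} Ind
                 \<and> \<not> has_minor_iso {1..n} Ind six whirl3
                 \<and> \<not> has_minor_iso {1..n} Ind six MK4}"

end

theory Submission
  imports Defs "HOL-Library.FuncSet" "HOL-Analysis.Harmonic_Numbers" "HOL-Number_Theory.Cong"
    "HOL-Real_Asymp.Real_Asymp"
begin

text \<open>A sparse paving matroid of rank \<open>r\<close> on \<open>n\<close> points is determined by its nonbases, which form an
  independent set \<open>I\<close> of the Johnson graph \<open>J(n, r)\<close>. If an \<open>r\<close>-set \<open>U\<close> has three neighbours
  \<open>U - x\<^sub>i + y\<^sub>i\<close> in \<open>I\<close>, then the \<open>x\<^sub>i\<close> are distinct and so are the \<open>y\<^sub>i\<close>, and contracting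
  \<open>U - {x\<^sub>1, x\<^sub>2, x\<^sub>3}\<close> and restricting to the \<open>x\<^sub>i\<close> and \<open>y\<^sub>i\<close> gives the whirl or \<open>M(K\<^sub>4)\<close>.
  So if both minors are excluded, counting edges between \<open>I\<close> and the \<open>r\<close>-sets gives
  \<open>card I * r * (n - r) \<le> 2 * (n choose r)\<close>, that is \<open>card I = O(N / n\<^sup>2)\<close> for
  \<open>N = n choose (n div 2)\<close>. There are only \<open>exp (O(N * ln n / n\<^sup>2))\<close> such sets, whereas the
  Graham--Sloane bound gives \<open>s n \<ge> 2 powr (N / n)\<close>.\<close>

section \<open>Rank and circuits of set families\<close>

lemma mrank_ge:
  assumes "finite X" "Y \<subseteq> X" "Y \<in> Ind"
  shows "card Y \<le> mrank Ind X"
  unfolding mrank_def using assms by (intro Max_ge) auto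

lemma mrank_attained:
  assumes "finite X" "{} \<in> Ind"
  obtains Y where "Y \<subseteq> X" "Y \<in> Ind" "card Y = mrank Ind X"
proof -
  have "mrank Ind X \<in> card ` {Y. Y \<subseteq> X \<and> Y \<in> Ind}"
    unfolding mrank_def using assms by (intro Max_in) auto
  then show ?thesis using that by auto
qed

text \<open>Contraction in \<open>minor_of\<close> is phrased through ranks; this turns its rank
  equation into a question of membership.\<close>

lemma mrank_eq_card_iff:
  assumes "finite X" "{} \<in> Ind"
  shows "mrank Ind X = card X \<longleftrightarrow> X \<in> Ind"
proof
  assume *: "mrank Ind X = card X"
  obtain Y where "Y \<subseteq> X" "Y \<in> Ind" "card Y = mrank Ind X"
    using mrank_attained[OF assms] .
  moreover from this * have "Y = X" using card_subset_eq[OF assms(1)] by simp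
  ultimately show "X \<in> Ind" by simp
next
  assume "X \<in> Ind"
  then have "card X \<le> mrank Ind X" using assms(1) by (intro mrank_ge) auto
  moreover obtain Y where "Y \<subseteq> X" "card Y = mrank Ind X"
    using mrank_attained[OF assms] .
  then have "mrank Ind X \<le> card X" using card_mono[OF assms(1)] by metis
  ultimately show "mrank Ind X = card X" by simp
qed

text \<open>A dependent subset of least cardinality is a circuit.\<close>

lemma dependent_contains_circuit:
  assumes "finite X" "X \<subseteq> E" "X \<notin> Ind"
  obtains C where "circuit E Ind C" "C \<subseteq> X"
proof -
  obtain C where C: "C \<subseteq> X" "C \<notin> Ind"
    and least: "\<And>D. D \<subseteq> X \<and> D \<notin> Ind \<Longrightarrow> card C \<le> card D"
    using ex_has_least_nat[of "\<lambda>D. D \<subseteq> X \<and> D \<notin> Ind" X card] assms by blast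
  have "C - {x} \<in> Ind" if "x \<in> C" for x
  proof (rule ccontr)
    assume "C - {x} \<notin> Ind"
    then have "card C \<le> card (C - {x})" using C by (intro least) auto
    moreover have "card (C - {x}) < card C"
      using that finite_subset[OF C(1) assms(1)] by (intro card_Diff1_less)
    ultimately show False by simp
  qed
  then have "circuit E Ind C" using C assms unfolding circuit_def by blast
  then show ?thesis using that C by blast
qed

lemma circuit_mrank:
  assumes "circuit E Ind C" "finite C" "{} \<in> Ind"
  shows "Suc (mrank Ind C) = card C"
proof -
  have C: "C \<notin> Ind" "\<And>x. x \<in> C \<Longrightarrow> C - {x} \<in> Ind"
    using assms(1) by (auto simp: circuit_def)
  then obtain x where x: "x \<in> C" using assms(3) by (metis ex_in_conv)
  have "card C - 1 \<le> mrank Ind C"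
    using mrank_ge[of C "C - {x}" Ind] C(2)[OF x] x assms(2) by auto
  moreover obtain Y where Y: "Y \<subseteq> C" "Y \<in> Ind" "card Y = mrank Ind C"
    using mrank_attained[OF assms(2,3)] .
  moreover have "Y \<noteq> C" using Y C by blast
  then have "card Y < card C" using Y assms(2) by (intro psubset_card_mono) auto
  ultimately show ?thesis by linarith
qed

section \<open>Sparse paving matroids as stable sets of Johnson graphs\<close>

text \<open>In the Johnson graph, edges join \<open>r\<close>-sets that meet in \<open>r - 1\<close>
  elements. For finite \<open>E\<close>, distinct \<open>r\<close>-sets never meet in more, so the
  strict inequality expresses nonadjacency; \<open>Suc\<close> avoids truncated subtraction.\<close>

definition johnson_stable :: "'a set \<Rightarrow> nat \<Rightarrow> 'a set set \<Rightarrow> bool" where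
  "johnson_stable E r I \<longleftrightarrow> I \<subseteq> {X. X \<subseteq> E \<and> card X = r}
     \<and> (\<forall>X\<in>I. \<forall>Y\<in>I. X \<noteq> Y \<longrightarrow> Suc (card (X \<inter> Y)) < r)"

text \<open>\<open>I\<close> plays the part of the nonbases, the dependent
  \<open>r\<close>-sets.\<close>

definition paving_indep :: "'a set \<Rightarrow> nat \<Rightarrow> 'a set set \<Rightarrow> 'a set set" where
  "paving_indep E r I = {Z. Z \<subseteq> E \<and> card Z \<le> r \<and> Z \<notin> I}"

lemma johnson_stable_layer:
  "johnson_stable E r I \<Longrightarrow> I \<subseteq> {X. X \<subseteq> E \<and> card X = r}"
  unfolding johnson_stable_def by (rule conjunct1)

lemma johnson_stableD:
  assumes "johnson_stable E r I" "X \<in> I" "Y \<in> I" "r \<le> Suc (card (X \<inter> Y))"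
  shows "X = Y"
  using assms unfolding johnson_stable_def by (meson not_le)

text \<open>Every dependent set with at most \<open>r\<close> elements is a circuit and a
  hyperplane. If two of them were adjacent, the rank increase forced by flatness would make one of
  them independent.\<close>

lemma sparse_paving_imp_johnson_stable:
  assumes M: "matroid E Ind" and sp: "sparse_paving E Ind"
  defines "r \<equiv> mrank Ind E"
  defines "I \<equiv> {X. X \<subseteq> E \<and> card X = r \<and> X \<notin> Ind}"
  shows "johnson_stable E r I" and "Ind = paving_indep E r I"
proof -
  have fE: "finite E" and e0: "{} \<in> Ind" and sub: "\<And>X. X \<in> Ind \<Longrightarrow> X \<subseteq> E"
    and down: "\<And>X Y. Y \<in> Ind \<Longrightarrow> X \<subseteq> Y \<Longrightarrow> X \<in> Ind"
    and aug: "\<And>X Y. X \<in> Ind \<Longrightarrow> Y \<in> Ind \<Longrightarrow> card X < card Y \<Longrightarrow> \<exists>y\<in>Y - X. insert y X \<in> Ind"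
    using M unfolding matroid_def by blast+
  have fin: "finite X" if "X \<subseteq> E" for X using that fE by (rule finite_subset)
  \<comment> \<open>The circuit \<open>C\<close> inside \<open>X\<close> has rank below
    \<open>r\<close>, so it is a hyperplane, of rank \<open>r - 1\<close> and hence of size
    \<open>r\<close>; this leaves no room for \<open>X\<close> to be larger.\<close>
  have circ: "circuit E Ind X \<and> card X = r \<and> hyperplane E Ind X"
    if X: "X \<subseteq> E" "X \<notin> Ind" "card X \<le> r" for X
  proof -
    obtain C where C: "circuit E Ind C" "C \<subseteq> X"
      using dependent_contains_circuit[OF fin[OF X(1)] X(1,2)] .
    have "Suc (mrank Ind C) = card C"
      using C X(1) e0 by (intro circuit_mrank fin) auto
    moreover have le: "card C \<le> card X" using C X fin by (simp add: card_mono)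
    ultimately have "mrank Ind C < r" using X by linarith
    then have h: "hyperplane E Ind C" using sp C unfolding sparse_paving_def r_def by blast
    then have "card C = r"
      using \<open>Suc (mrank Ind C) = card C\<close> unfolding hyperplane_def r_def by simp
    then have "C = X" using card_subset_eq[OF fin[OF X(1)] C(2)] X le by simp
    then show ?thesis using C h \<open>card C = r\<close> by simp
  qed
  show "Ind = paving_indep E r I"
  proof
    show "Ind \<subseteq> paving_indep E r I"
      using sub mrank_ge[OF fE] unfolding paving_indep_def I_def r_def by auto
    show "paving_indep E r I \<subseteq> Ind"
      using circ unfolding paving_indep_def I_def by blast
  qed
  show "johnson_stable E r I"
    unfolding johnson_stable_def
  proof (intro conjI ballI impI)
    show "I \<subseteq> {X. X \<subseteq> E \<and> card X = r}" unfolding I_def by auto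
    fix X Y assume XY: "X \<in> I" "Y \<in> I" "X \<noteq> Y"
    then have X: "X \<subseteq> E" "card X = r" "X \<notin> Ind" and Y: "Y \<subseteq> E" "card Y = r" "Y \<notin> Ind"
      unfolding I_def by auto
    show "Suc (card (X \<inter> Y)) < r"
    proof (rule ccontr)
      assume "\<not> Suc (card (X \<inter> Y)) < r"
      moreover have "card (X \<inter> Y) < r"
      proof -
        have "X \<inter> Y \<noteq> X"
          using XY(3) X Y card_subset_eq[OF fin[OF Y(1)], of X] by auto
        then show ?thesis using X fin by (metis inf_le1 psubsetI psubset_card_mono)
      qed
      ultimately have c: "Suc (card (X \<inter> Y)) = r" by simp
      have "card (X - Y) = 1" "card (Y - X) = 1"
        using c X Y fin by (simp_all add: card_Diff_subset_Int Int_commute)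
      then obtain x y where xy: "X - Y = {x}" "Y - X = {y}" by (meson card_1_singletonE)
      have "flat E Ind X" "mrank Ind X + 1 = r"
        using circ[of X] X unfolding hyperplane_def r_def by auto
      moreover have "y \<in> E - X" using xy Y by blast
      ultimately have "mrank Ind X < mrank Ind (insert y X)" "mrank Ind X + 1 = r"
        unfolding flat_def by blast+
      then have "r \<le> mrank Ind (insert y X)" by simp
      moreover have "finite (insert y X)" using X fin by simp
      from mrank_attained[OF this e0] obtain B where B: "B \<subseteq> insert y X" "B \<in> Ind" "card B = mrank Ind (insert y X)" .
      ultimately have lt: "card (X \<inter> Y) < card B" using c by simp
      have "X \<inter> Y = X - {x}" using xy by blast
      moreover have "x \<in> X" using xy by blast
      moreover have "circuit E Ind X" using circ[of X] X by simp
      ultimately have "X \<inter> Y \<in> Ind" unfolding circuit_def by simp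
      \<comment> \<open>\<open>B\<close> lies in \<open>insert y X\<close>, so an element of
        \<open>B\<close> that augments \<open>X \<inter> Y\<close> is \<open>x\<close> or
        \<open>y\<close>, which makes \<open>X\<close> or \<open>Y\<close> independent.\<close>
      then obtain z where z: "z \<in> B - X \<inter> Y" "insert z (X \<inter> Y) \<in> Ind"
        using aug[OF _ B(2) lt] by blast
      then have "z = x \<or> z = y" using B xy by blast
      then have "insert z (X \<inter> Y) = X \<or> insert z (X \<inter> Y) = Y" using xy by blast
      then show False using z X Y by auto
    qed
  qed
qed

text \<open>Nonadjacency enters through \<open>swap\<close>, which yields both augmentation up to
  size \<open>r\<close> and the flatness of the members of \<open>I\<close>. The condition
  \<open>0 < r\<close> keeps the empty set independent.\<close>

lemma paving_indep_sparse_paving: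
  assumes fE: "finite E" and r: "0 < r" "r < card E" and st: "johnson_stable E r I"
  shows "matroid E (paving_indep E r I)" and "sparse_paving E (paving_indep E r I)"
proof -
  let ?P = "paving_indep E r I"
  have I: "\<And>X. X \<in> I \<Longrightarrow> X \<subseteq> E \<and> card X = r" using johnson_stable_layer[OF st] by blast
  have fin: "finite X" if "X \<subseteq> E" for X using that fE by (rule finite_subset)
  have e0: "{} \<in> ?P" using I[of "{}"] r unfolding paving_indep_def by auto
  have small: "X \<in> ?P" if "X \<subseteq> E" "card X < r" for X
    using that I unfolding paving_indep_def by auto
  \<comment> \<open>The two extensions are distinct and meet in \<open>W\<close>, of size
    \<open>r - 1\<close>, so they cannot both lie in \<open>I\<close>.\<close>
  have swap: "insert a W \<in> ?P \<or> insert b W \<in> ?P"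
    if W: "W \<subseteq> E" "Suc (card W) = r" "a \<in> E - W" "b \<in> E - W" "a \<noteq> b" for W a b
  proof (rule ccontr)
    assume "\<not> ?thesis"
    then have "insert a W \<in> I" "insert b W \<in> I"
      using W fin[of W] unfolding paving_indep_def by auto
    moreover have "insert a W \<inter> insert b W = W" using W by blast
    ultimately have "insert a W = insert b W" using johnson_stableD[OF st] W by simp
    then show False using W by blast
  qed
  show "matroid E ?P"
    unfolding matroid_def
  proof (intro conjI allI impI)
    show "finite E" "{} \<in> ?P" by fact+
    show "?P \<subseteq> Pow E" unfolding paving_indep_def by auto
    fix X Y assume "Y \<in> ?P \<and> X \<subseteq> Y"
    then have XY: "Y \<in> ?P" "X \<subseteq> Y" "Y \<subseteq> E" "card Y \<le> r" unfolding paving_indep_def by auto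
    show "X \<in> ?P"
    proof (cases "X = Y")
      case False
      then have "card X < card Y" using XY fin by (simp add: psubset_card_mono psubsetI)
      then show ?thesis using XY small[of X] by auto
    qed (use XY in simp)
  next
    fix X Y assume "X \<in> ?P \<and> Y \<in> ?P \<and> card X < card Y"
    then have XY: "X \<in> ?P" "Y \<in> ?P" "X \<subseteq> E" "Y \<subseteq> E" "card X < card Y" "card Y \<le> r"
      unfolding paving_indep_def by auto
    then have "\<not> Y \<subseteq> X" using fin card_mono by (metis not_le)
    then obtain y where y: "y \<in> Y - X" by blast
    \<comment> \<open>With a single candidate, cardinalities force \<open>Y = insert y X\<close>.
      With two, either \<open>swap\<close> admits one of them or the extension has fewer than
      \<open>r\<close> elements.\<close>
    show "\<exists>y\<in>Y - X. insert y X \<in> ?P"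
    proof (cases "Y - X = {y}")
      case True
      then have "card Y \<le> card (insert y X)" using fin XY by (intro card_mono) auto
      then have "Suc (card X) = card Y" using XY y fin[of X] by simp
      then have "card (insert y X) \<le> card Y" using y fin[of X] XY by simp
      moreover have "Y \<subseteq> insert y X" using True by blast
      ultimately have "Y = insert y X" using fin XY by (meson card_seteq finite.insertI)
      then show ?thesis using XY y by auto
    next
      case False
      then obtain z where z: "z \<in> Y - X" "z \<noteq> y" using y by blast
      show ?thesis
      proof (cases "Suc (card X) = r")
        case True
        then show ?thesis using swap[of X y z] XY y z by blast
      next
        case False
        then have "insert y X \<in> ?P" using XY y fin[of X] by (intro small) auto
        then show ?thesis using y by blast
      qed
    qed
  qed
  have rank_E: "mrank ?P E \<le> r"
  proof -
    obtain Y where "Y \<in> ?P" "card Y = mrank ?P E" using mrank_attained[OF fE e0] .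
    then show ?thesis unfolding paving_indep_def by auto
  qed
  \<comment> \<open>Exchanging some \<open>x\<close> in \<open>C\<close> for \<open>e\<close> gives
    a neighbour of \<open>C\<close>, hence an independent \<open>r\<close>-set inside
    \<open>insert e C\<close>.\<close>
  have rank_big: "r \<le> mrank ?P (insert e C)" if "C \<in> I" "e \<in> E - C" for C e
  proof -
    have C: "C \<subseteq> E" "card C = r" "finite C" using that I fin by auto
    then obtain x where x: "x \<in> C" using r by fastforce
    have "insert x (C - {x}) \<in> ?P \<or> insert e (C - {x}) \<in> ?P"
      using x C that r by (intro swap) auto
    moreover have "insert x (C - {x}) \<notin> ?P"
      using x that by (simp add: insert_absorb paving_indep_def)
    moreover have "insert e (C - {x}) \<subseteq> insert e C" by blast
    ultimately have "card (insert e (C - {x})) \<le> mrank ?P (insert e C)"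
      using C by (intro mrank_ge) auto
    then show ?thesis using C x that r by (simp add: card_insert_if split: if_splits)
  qed
  show "sparse_paving E ?P"
    unfolding sparse_paving_def
  proof (intro allI impI)
    fix C assume "circuit E ?P C \<and> mrank ?P C < mrank ?P E"
    then have c: "circuit E ?P C" and lt: "mrank ?P C < r" and ltE: "mrank ?P C < mrank ?P E"
      using rank_E by auto
    then have C: "C \<subseteq> E" "C \<notin> ?P" "finite C" using fin unfolding circuit_def by auto
    have rC: "Suc (mrank ?P C) = card C" using circuit_mrank[OF c C(3) e0] .
    then have CI: "C \<in> I" using C lt unfolding paving_indep_def by auto
    then have cC: "card C = r" using I by blast
    have "flat E ?P C" unfolding flat_def using rank_big[OF CI] lt C by fastforce
    moreover have "mrank ?P C + 1 = mrank ?P E" using rC cC rank_E ltE by simp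
    ultimately show "hyperplane E ?P C" unfolding hyperplane_def by blast
  qed
qed

section \<open>The excluded minors\<close>

text \<open>Allows an isomorphism to be checked on subsets of the concrete set \<open>six\<close>,
  by a map in the direction opposite to that of \<open>matroid_iso\<close>.\<close>

lemma matroid_iso_inverse:
  assumes "bij_betw g E2 E1" "\<And>X. X \<subseteq> E2 \<Longrightarrow> g ` X \<in> I1 \<longleftrightarrow> X \<in> I2"
  shows "matroid_iso E1 I1 E2 I2"
proof -
  let ?f = "inv_into E2 g"
  have b: "bij_betw ?f E1 E2" using assms(1) by (rule bij_betw_inv_into)
  have "X \<in> I1 \<longleftrightarrow> ?f ` X \<in> I2" if "X \<subseteq> E1" for X
  proof -
    have "?f ` X \<subseteq> E2" using b that by (auto simp: bij_betw_def)
    moreover have "g ` ?f ` X = X"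
      using assms(1) that by (metis bij_betw_imp_surj_on image_inv_into_cancel)
    ultimately show ?thesis using assms(2) by metis
  qed
  then show ?thesis using b unfolding matroid_iso_def by blast
qed

text \<open>An exhaustive check of 64 subsets. Besides the three lines, only \<open>{1,3,5}\<close>
  may fail to be one exchange away from a line, which is why exactly two minors arise.\<close>

lemma six_triples:
  assumes "K \<subseteq> six" "card K = 3" "K \<notin> {{0,1,2},{2,3,4},{4,5,0},{1,3,5}}"
  shows "\<exists>T\<in>{{0,1,2},{2,3,4},{4,5,0}}. K \<noteq> T \<and> card (K \<inter> T) = 2"
proof -
  have "\<forall>K\<in>Pow {0,1,2,3,4,5::nat}. card K = 3 \<longrightarrow>
      K \<in> {{0,1,2},{2,3,4},{4,5,0},{1,3,5}} \<or>
      (\<exists>T\<in>{{0,1,2},{2,3,4},{4,5,0}}. K \<noteq> T \<and> card (K \<inter> T) = 2)"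
    by code_simp
  moreover have "six = {0,1,2,3,4,5}" unfolding six_def by auto
  ultimately show ?thesis using assms by (metis PowI)
qed

lemma johnson_neighbour:
  assumes "finite U" "finite X" "card U = r" "card X = r" "Suc (card (X \<inter> U)) = r"
  obtains x y where "x \<in> U" "y \<in> X - U" "X = insert y (U - {x})"
proof -
  have "card (X - U) = 1" "card (U - X) = 1"
    using assms by (simp_all add: card_Diff_subset_Int Int_commute)
  then obtain x y where xy: "U - X = {x}" "X - U = {y}" by (meson card_1_singletonE)
  show ?thesis by (rule that[of x y]) (use xy in blast)+
qed

text \<open>Exhibiting a large common subset \<open>W\<close> saves computing
  \<open>X \<inter> Y\<close>.\<close>

lemma johnson_stable_eqI:
  assumes "johnson_stable E r I" "finite E" "X \<in> I" "Y \<in> I" "W \<subseteq> X" "W \<subseteq> Y" "r \<le> Suc (card W)"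
  shows "X = Y"
proof (rule johnson_stableD[OF assms(1,3,4)])
  have "X \<subseteq> E" using johnson_stable_layer[OF assms(1)] assms(3) by auto
  then have "card W \<le> card (X \<inter> Y)" using assms by (intro card_mono) (auto intro: finite_subset)
  then show "r \<le> Suc (card (X \<inter> Y))" using assms by simp
qed

text \<open>The neighbours arise from \<open>U\<close> by exchanging \<open>a\<close> for
  \<open>d\<close>, \<open>c\<close> for \<open>f\<close> and \<open>e\<close> for \<open>b\<close>.
  Contracting \<open>U - {a, c, e}\<close> turns them into the lines \<open>{c, d, e}\<close>,
  \<open>{e, f, a}\<close> and \<open>{a, b, c}\<close>. Stability leaves only
  \<open>{b, d, f}\<close> undecided: dependent gives \<open>MK4\<close>, independent gives
  \<open>whirl3\<close>.\<close>

lemma three_neighbours_imp_minor: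
  assumes fE: "finite E" and st: "johnson_stable E r I" and U: "U \<subseteq> E" "card U = r"
    and X: "X1 \<in> I" "X2 \<in> I" "X3 \<in> I" and ne: "X1 \<noteq> X2" "X2 \<noteq> X3" "X1 \<noteq> X3"
    and adj: "\<And>X. X \<in> {X1, X2, X3} \<Longrightarrow> Suc (card (X \<inter> U)) = r"
  shows "has_minor_iso E (paving_indep E r I) six whirl3 \<or> has_minor_iso E (paving_indep E r I) six MK4"
proof -
  let ?P = "paving_indep E r I"
  have I: "\<And>X. X \<in> I \<Longrightarrow> X \<subseteq> E \<and> card X = r" using johnson_stable_layer[OF st] by blast
  have fin: "finite X" if "X \<subseteq> E" for X using that fE by (rule finite_subset)
  have fU: "finite U" using U fin by blast
  have nb: "\<exists>x y. x \<in> U \<and> y \<in> E - U \<and> X = insert y (U - {x})" if XX: "X \<in> {X1, X2, X3}" for X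
  proof -
    have XE: "X \<subseteq> E" "card X = r" using XX X I by auto
    obtain x y where "x \<in> U" "y \<in> X - U" "X = insert y (U - {x})"
      using johnson_neighbour[OF fU fin[OF XE(1)] U(2) XE(2) adj[OF XX]] .
    with XE show ?thesis by blast
  qed
  obtain c1 d where d: "c1 \<in> U" "d \<in> E - U" "X1 = insert d (U - {c1})" using nb[of X1] by blast
  obtain c f where f: "c \<in> U" "f \<in> E - U" "X2 = insert f (U - {c})" using nb[of X2] by blast
  obtain e b where b: "e \<in> U" "b \<in> E - U" "X3 = insert b (U - {e})" using nb[of X3] by blast
  define a where "a = c1"
  \<comment> \<open>Equal removed elements would leave the common subset \<open>U - {x}\<close>,
    equal added ones \<open>insert y (U - {x, x'})\<close>; either has \<open>r - 1\<close>
    elements, against stability.\<close>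
  have distinct_swaps: "x \<noteq> x' \<and> y \<noteq> y'"
    if h: "insert y (U - {x}) \<in> I" "insert y' (U - {x'}) \<in> I"
      "insert y (U - {x}) \<noteq> insert y' (U - {x'})" "x \<in> U" "x' \<in> U" "y \<in> E - U" "y' \<in> E - U"
    for x y x' y'
  proof -
    have x: "x \<noteq> x'"
    proof
      assume "x = x'"
      moreover have "r \<le> Suc (card (U - {x}))" using U fU h(4) by simp
      ultimately have "insert y (U - {x}) = insert y' (U - {x'})"
        using johnson_stable_eqI[OF st fE h(1,2), of "U - {x}"] by blast
      then show False using h(3) by blast
    qed
    moreover have "y \<noteq> y'"
    proof
      assume "y = y'"
      moreover have "card {x, x'} \<le> card U" using h(4,5) fU by (intro card_mono) auto
      then have "r \<le> Suc (card (insert y (U - {x, x'})))"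
        using U fU h(4,5,6) x by (simp add: card_Diff_subset)
      ultimately have "insert y (U - {x}) = insert y' (U - {x'})"
        using johnson_stable_eqI[OF st fE h(1,2), of "insert y (U - {x, x'})"] by blast
      then show False using h(3) by blast
    qed
    ultimately show ?thesis by blast
  qed
  have "a \<noteq> c" "c \<noteq> e" "a \<noteq> e" "d \<noteq> f" "f \<noteq> b" "d \<noteq> b"
    using distinct_swaps[of d c1 f c] distinct_swaps[of f c b e] distinct_swaps[of d c1 b e]
      X ne d f b unfolding a_def by auto
  then have dist: "distinct [a, b, c, d, e, f]" using d f b unfolding a_def by auto
  define F where "F = {a, b, c, d, e, f}"
  define C where "C = U - {a, c, e}"
  \<comment> \<open>The list order follows the encoding of the six points as \<open>0\<close> to
    \<open>5\<close>, so the lines of \<open>six\<close> correspond to \<open>X3\<close>,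
    \<open>X1\<close> and \<open>X2\<close>.\<close>
  define g where "g = (!) [a, b, c, d, e, f]"
  have FE: "F \<subseteq> E" and CE: "C \<subseteq> E" and CF: "C \<inter> F = {}"
    using U d f b unfolding F_def C_def a_def by auto
  have "card {a, c, e} \<le> card U" using d f b fU unfolding a_def by (intro card_mono) auto
  then have r3: "3 \<le> r" using dist U by simp
  have cC: "card C + 3 = r"
    using U d f b fU dist r3 unfolding C_def by (subst card_Diff_subset) (auto simp: a_def)
  have six: "six = {..<6}" unfolding six_def by auto
  have bij: "bij_betw g six F"
    unfolding g_def by (rule bij_betw_nth[OF dist]) (auto simp: six F_def)
  then have inj: "inj_on g six" and im: "g ` six = F" unfolding bij_betw_def by auto
  have gX: "g ` {0,1,2} \<union> C = X3" "g ` {2,3,4} \<union> C = X1" "g ` {4,5,0} \<union> C = X2"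
    using d f b dist unfolding g_def C_def a_def by auto
  have line_in_I: "\<forall>T\<in>{{0,1,2},{2,3,4},{4,5,0}}. g ` T \<union> C \<in> I"
    using gX X by (simp del: image_insert)
  have cg: "card (g ` K \<union> C) = card K + card C" if "K \<subseteq> six" for K
  proof -
    have "g ` K \<subseteq> F" using im that by blast
    then have "card (g ` K \<union> C) = card (g ` K) + card C"
      using CF FE CE fin by (intro card_Un_disjoint) auto
    then show ?thesis using card_image inj inj_on_subset that by metis
  qed
  \<comment> \<open>A triple outside the four special ones shares two points with some line
    \<open>T\<close>. After adding \<open>C\<close>, the two \<open>r\<close>-sets share
    \<open>r - 1\<close> elements, and the one from \<open>T\<close> is already in
    \<open>I\<close>.\<close>
  have triple: "g ` K \<union> C \<in> I \<longleftrightarrow>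
      K \<in> {{0,1,2},{2,3,4},{4,5,0}} \<or> K = {1,3,5} \<and> g ` {1,3,5} \<union> C \<in> I"
    if K: "K \<subseteq> six" "card K = 3" for K
  proof (cases "K \<in> {{0,1,2},{2,3,4},{4,5,0},{1,3,5}}")
    case True
    then consider "K \<in> {{0,1,2},{2,3,4},{4,5,0}}" | "K = {1,3,5}" by blast
    then show ?thesis
    proof cases
      case 1
      with line_in_I have "g ` K \<union> C \<in> I" by (rule bspec)
      with 1 show ?thesis by simp
    next
      case 2
      moreover have "{1,3,5::nat} \<notin> {{0,1,2},{2,3,4},{4,5,0}}" by code_simp
      ultimately show ?thesis by simp
    qed
  next
    case False
    then obtain T where T: "T \<in> {{0,1,2},{2,3,4},{4,5,0}}" "K \<noteq> T" "card (K \<inter> T) = 2"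
      using six_triples[OF K False] by (elim bexE conjE)
    have T6: "T \<subseteq> six" using T(1) unfolding six by auto
    have TI: "g ` T \<union> C \<in> I" using line_in_I T(1) by (rule bspec)
    have "g ` K \<union> C \<notin> I"
    proof
      assume "g ` K \<union> C \<in> I"
      moreover have "K \<inter> T \<subseteq> six" using K by blast
      then have "r \<le> Suc (card (g ` (K \<inter> T) \<union> C))" using cg T(3) cC by simp
      ultimately have "g ` K \<union> C = g ` T \<union> C"
        using johnson_stable_eqI[OF st fE _ TI, of _ "g ` (K \<inter> T) \<union> C"] by blast
      moreover have "g ` K \<inter> C = {}" "g ` T \<inter> C = {}" using K T6 im CF by blast+
      ultimately have "g ` K = g ` T" by blast
      then show False using T(2) inj K T6 by (simp add: inj_on_image_eq_iff)
    qed
    then show ?thesis using False by auto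
  qed
  have e0: "{} \<in> ?P" using I[of "{}"] r3 unfolding paving_indep_def by auto
  have CP: "C \<in> ?P" using I[of C] cC CE unfolding paving_indep_def by auto
  define Ind' where "Ind' = {J. J \<subseteq> F \<and> mrank ?P (J \<union> C) = card J + mrank ?P C}"
  have "minor_of F Ind' E ?P"
    unfolding minor_of_def
  proof (intro exI conjI)
    have "E - C - (E - C - F) = F" using FE CF by blast
    then show "F = E - C - (E - C - F)"
      "Ind' = {J. J \<subseteq> E - C - (E - C - F) \<and> mrank ?P (J \<union> C) = card J + mrank ?P C}"
      unfolding Ind'_def by simp_all
  qed (use CE in auto)
  \<comment> \<open>Since \<open>C\<close> is independent, the rank equation in \<open>Ind'\<close>
    says that the union with \<open>C\<close> is independent.\<close>
  have mem: "g ` K \<in> Ind' \<longleftrightarrow> card K \<le> 3 \<and> g ` K \<union> C \<notin> I" if "K \<subseteq> six" for K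
  proof -
    have gF: "g ` K \<subseteq> F" using im that by blast
    have sub: "g ` K \<union> C \<subseteq> E" using gF FE CE by blast
    have "card (g ` K) = card K" using card_image inj inj_on_subset that by metis
    then have "g ` K \<in> Ind' \<longleftrightarrow> g ` K \<union> C \<in> ?P"
      using gF mrank_eq_card_iff[OF fin[OF CE] e0] CP cg[OF that]
        mrank_eq_card_iff[OF fin[OF sub] e0] unfolding Ind'_def by simp
    then show ?thesis using sub cg[OF that] cC unfolding paving_indep_def by auto
  qed
  have mem': "g ` K \<in> Ind' \<longleftrightarrow> card K \<le> 3 \<and>
      K \<notin> {{0,1,2},{2,3,4},{4,5,0}} \<and> \<not> (K = {1,3,5} \<and> g ` {1,3,5} \<union> C \<in> I)" if "K \<subseteq> six" for K
  proof (cases "card K = 3")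
    case True
    then show ?thesis using mem[OF that] triple[OF that] by simp
  next
    case False
    then have "K \<notin> {{0,1,2},{2,3,4},{4,5,0}} \<and> K \<noteq> {1,3,5}" by auto
    moreover have "g ` K \<union> C \<notin> I" using False cg[OF that] cC I by fastforce
    ultimately show ?thesis using mem[OF that] by simp
  qed
  show ?thesis
  proof (cases "g ` {1,3,5} \<union> C \<in> I")
    case True
    then have "matroid_iso F Ind' six MK4"
      by (intro matroid_iso_inverse[OF bij]) (auto simp: mem' MK4_def)
    then show ?thesis using \<open>minor_of F Ind' E ?P\<close> unfolding has_minor_iso_def by blast
  next
    case False
    then have "matroid_iso F Ind' six whirl3"
      by (intro matroid_iso_inverse[OF bij]) (auto simp: mem' whirl3_def)
    then show ?thesis using \<open>minor_of F Ind' E ?P\<close> unfolding has_minor_iso_def by blast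
  qed
qed

section \<open>Bounding the number of nonbases\<close>

text \<open>Distinct pairs in \<open>X \<times> (E - X)\<close> give distinct exchanges
  \<open>insert y (X - {x})\<close>, all adjacent to \<open>X\<close>.\<close>

lemma card_johnson_neighbours_ge:
  assumes fE: "finite E" and X: "X \<subseteq> E" "card X = r"
  shows "r * (card E - r) \<le> card {U. U \<subseteq> E \<and> card U = r \<and> Suc (card (X \<inter> U)) = r}"
proof -
  let ?N = "{U. U \<subseteq> E \<and> card U = r \<and> Suc (card (X \<inter> U)) = r}"
  let ?f = "\<lambda>(x, y). insert y (X - {x})"
  have fX: "finite X" using X fE finite_subset by blast
  have "card (X \<times> (E - X)) \<le> card ?N"
  proof (rule card_inj_on_le)
    show "inj_on ?f (X \<times> (E - X))"
    proof (rule inj_onI, clarify)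
      fix x y x' y' assume h: "x \<in> X" "x' \<in> X" "y \<in> E" "y \<notin> X" "y' \<in> E" "y' \<notin> X"
        "insert y (X - {x}) = insert y' (X - {x'})"
      then have "y = y'" by blast
      moreover have "x = x'"
      proof (rule ccontr)
        assume "x \<noteq> x'"
        then have "x' \<in> insert y (X - {x})" using h(2) by blast
        then show False unfolding h(7) using h(2,6) by blast
      qed
      ultimately show "x = x' \<and> y = y'" by blast
    qed
    show "?f ` (X \<times> (E - X)) \<subseteq> ?N"
    proof clarify
      fix x y assume h: "x \<in> X" "y \<in> E" "y \<notin> X"
      have "0 < card X" using h fX card_gt_0_iff by blast
      then have "card (insert y (X - {x})) = r" using h X fX by simp
      moreover have "X \<inter> insert y (X - {x}) = X - {x}" using h by blast
      then have "Suc (card (X \<inter> insert y (X - {x}))) = r"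
        using h X fX \<open>0 < card X\<close> by simp
      ultimately show "insert y (X - {x}) \<subseteq> E \<and> card (insert y (X - {x})) = r \<and>
          Suc (card (X \<inter> insert y (X - {x}))) = r" using h X by blast
    qed
    show "finite ?N" using fE by simp
  qed
  then show ?thesis using X fX fE by (simp add: card_cartesian_product card_Diff_subset)
qed

text \<open>Double counting of adjacent pairs of some \<open>X\<close> in \<open>I\<close> and an
  \<open>r\<close>-set \<open>U\<close>: each \<open>X\<close> has at least
  \<open>r * (card E - r)\<close> neighbours, while a third neighbour in \<open>I\<close> of any
  \<open>U\<close> would produce an excluded minor.\<close>

lemma card_nonbases_le_if_no_minor:
  assumes fE: "finite E" and st: "johnson_stable E r I"
    and no: "\<not> has_minor_iso E (paving_indep E r I) six whirl3"
      "\<not> has_minor_iso E (paving_indep E r I) six MK4"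
  shows "card I * (r * (card E - r)) \<le> 2 * (card E choose r)"
proof -
  let ?V = "{U. U \<subseteq> E \<and> card U = r}"
  let ?R = "\<lambda>X U. Suc (card (X \<inter> U)) = r"
  have IV: "I \<subseteq> ?V" using st by (rule johnson_stable_layer)
  have fV: "finite ?V" using fE by simp
  then have fI: "finite I" using IV finite_subset by blast
  have "card I * (r * (card E - r)) = (\<Sum>X\<in>I. r * (card E - r))" by simp
  also have "\<dots> \<le> (\<Sum>X\<in>I. card {U\<in>?V. ?R X U})"
  proof (rule sum_mono)
    fix X assume "X \<in> I"
    then show "r * (card E - r) \<le> card {U\<in>?V. ?R X U}"
      using card_johnson_neighbours_ge[OF fE, of X r] IV by (auto simp: conj_assoc)
  qed
  also have "\<dots> = (\<Sum>U\<in>?V. card {X\<in>I. ?R X U})"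
    by (rule sum_multicount_gen[OF fI fV]) simp
  also have "\<dots> \<le> (\<Sum>U\<in>?V. 2)"
  proof (rule sum_mono, rule ccontr)
    fix U assume U: "U \<in> ?V" and "\<not> card {X\<in>I. ?R X U} \<le> 2"
    then have "3 \<le> card {X\<in>I. ?R X U}" by simp
    then obtain S where S: "S \<subseteq> {X\<in>I. ?R X U}" "card S = 3"
      by (rule obtain_subset_with_card_n)
    from S(2) obtain X1 X2 X3 where "S = {X1, X2, X3}" and ne: "X1 \<noteq> X2" "X2 \<noteq> X3" "X1 \<noteq> X3"
      unfolding card_3_iff by blast
    then have "X1 \<in> I" "X2 \<in> I" "X3 \<in> I" "\<And>X. X \<in> {X1, X2, X3} \<Longrightarrow> ?R X U"
      using S(1) by auto
    then show False
      using three_neighbours_imp_minor[OF fE st _ _ _ _ _ ne, of U] U no by blast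
  qed
  also have "\<dots> = 2 * (card E choose r)" using fE by (simp add: n_subsets)
  finally show ?thesis .
qed

text \<open>Makes the edge count uniform in \<open>r\<close>. Absorption rewrites the left side as
  \<open>(r + 1) * (n - r + 1) * (n + 2 choose (r + 1))\<close>. Pascal's rule, used twice, splits
  the coefficient into four, each at most the central one; \<open>r + 1 \<le> 2 * r\<close> and
  \<open>n - r + 1 \<le> 2 * (n - r)\<close> supply the other factor 4.\<close>

lemma binomial_le_central_mult:
  assumes "0 < r" "r < n"
  shows "((n + 2) * (n + 1)) * (n choose r) \<le> 16 * (n choose (n div 2)) * (r * (n - r))"
proof -
  obtain k where k: "r = Suc k" using assms gr0_conv_Suc by blast
  have "((n + 2) * (n + 1)) * (n choose r) = (n + 2) * ((n + 1) * (n choose r))"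
    by (simp only: mult.assoc)
  also have "(n + 1) * (n choose r) = (n + 1 - r) * (n + 1 choose r)"
    using binomial_absorb_comp[of "n + 1" r] by simp
  also have "(n + 2) * \<dots> = (n + 1 - r) * ((n + 2) * (n + 1 choose r))"
    by (simp only: mult.left_commute)
  also have "(n + 2) * (n + 1 choose r) = (n + 2 choose (r + 1)) * (r + 1)"
    using Suc_times_binomial_eq[of "n + 1" r] by simp
  also have "n + 1 - r = n - r + 1" using assms by simp
  also have "(n - r + 1) * ((n + 2 choose (r + 1)) * (r + 1)) =
      (n + 2 choose (r + 1)) * ((r + 1) * (n - r + 1))"
    by (simp only: mult_ac)
  also have "n + 2 choose (r + 1) = (n choose k) + 2 * (n choose r) + (n choose (r + 1))"
    unfolding k by simp
  also have "\<dots> * ((r + 1) * (n - r + 1)) \<le> (4 * (n choose (n div 2))) * ((2 * r) * (2 * (n - r)))"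
  proof (intro mult_mono)
    show "(n choose k) + 2 * (n choose r) + (n choose (r + 1)) \<le> 4 * (n choose (n div 2))"
      using binomial_maximum[of n k] binomial_maximum[of n r] binomial_maximum[of n "r + 1"] by simp
  qed (use assms in auto)
  also have "\<dots> = 16 * (n choose (n div 2)) * (r * (n - r))" by simp
  finally show ?thesis .
qed

text \<open>For \<open>0 < r < n\<close> the factor \<open>r * (n - r)\<close> cancels, and
  \<open>32\<close> is \<open>2 * 16\<close>. The summand \<open>1\<close> covers
  \<open>r = 0\<close> and \<open>r = n\<close>, where there is a single
  \<open>r\<close>-set.\<close>

lemma card_nonbases_le:
  assumes fE: "finite E" and n: "card E = n" "0 < n" and r: "r \<le> n" and st: "johnson_stable E r I"
    and no: "\<not> has_minor_iso E (paving_indep E r I) six whirl3"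
      "\<not> has_minor_iso E (paving_indep E r I) six MK4"
  shows "real (card I) \<le> 32 * real (n choose (n div 2)) / real n ^ 2 + 1"
proof (cases "0 < r \<and> r < n")
  case True
  let ?N = "n choose (n div 2)" and ?p = "r * (n - r)"
  have "(card I * ((n + 2) * (n + 1))) * ?p = (card I * ?p) * ((n + 2) * (n + 1))"
    by (simp only: mult_ac)
  also have "\<dots> \<le> (2 * (n choose r)) * ((n + 2) * (n + 1))"
    using card_nonbases_le_if_no_minor[OF fE st no] n by (intro mult_right_mono) auto
  also have "\<dots> \<le> (32 * ?N) * ?p"
    using binomial_le_central_mult[of r n] True by (simp add: algebra_simps)
  finally have "card I * ((n + 2) * (n + 1)) \<le> 32 * ?N" using True by simp
  moreover have "card I * n\<^sup>2 \<le> card I * ((n + 2) * (n + 1))"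
    by (intro mult_left_mono) (auto simp: power2_eq_square)
  ultimately have "card I * n\<^sup>2 \<le> 32 * ?N" by linarith
  then have "real (card I * n\<^sup>2) \<le> real (32 * ?N)" by (simp only: of_nat_le_iff)
  then have "real (card I) \<le> 32 * real ?N / real n ^ 2"
    using n by (simp add: field_simps)
  then show ?thesis by simp
next
  case False
  then have "n choose r = 1" using r by auto
  then have "card {X. X \<subseteq> E \<and> card X = r} = 1" using fE n by (simp add: n_subsets)
  moreover have "card I \<le> card {X. X \<subseteq> E \<and> card X = r}"
    using johnson_stable_layer[OF st] fE by (intro card_mono) auto
  ultimately have "real (card I) \<le> 1" by simp
  then show ?thesis by (simp add: add_increasing)
qed

section \<open>Upper bound for \<open>sX\<close>\<close>

text \<open>Give each subset \<open>J\<close> the weight \<open>(1 / m) ^ card J\<close>. The small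
  subsets weigh at least \<open>(1 / m) ^ q\<close> each, and all subsets together weigh
  \<open>(1 / m + 1) ^ card A\<close>.\<close>

lemma card_small_subsets_le:
  assumes "finite A" and m: "1 \<le> (m::real)"
  shows "real (card {J. J \<subseteq> A \<and> card J \<le> q}) \<le> m ^ q * exp (real (card A) / m)"
proof -
  let ?S = "{J. J \<subseteq> A \<and> card J \<le> q}"
  have "real (card ?S) * (1 / m) ^ q = (\<Sum>J\<in>?S. (1 / m) ^ q)" by simp
  also have "\<dots> \<le> (\<Sum>J\<in>?S. (1 / m) ^ card J)"
    using m by (intro sum_mono power_decreasing) auto
  also have "\<dots> \<le> (\<Sum>J\<in>Pow A. (1 / m) ^ card J)"
    using assms by (intro sum_mono2) auto
  also have "\<dots> = (1 / m + 1) ^ card A"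
    using prod_add[OF \<open>finite A\<close>, of "\<lambda>_. 1 / m" "\<lambda>_. 1"] by simp
  also have "\<dots> \<le> exp (1 / m) ^ card A"
    using m exp_ge_add_one_self[of "1 / m"] by (intro power_mono) (auto simp: add.commute)
  also have "\<dots> = exp (real (card A) / m)" by (simp flip: exp_of_nat_mult)
  finally show ?thesis using m by (simp add: field_simps)
qed

text \<open>There are \<open>n + 1\<close> possible ranks, and each rank leaves a choice of few
  nonbases. Counting small families with \<open>m = n^2\<close> keeps the exponential factor at
  \<open>N / n^2\<close>, the order of the bound on the nonbases.\<close>

lemma sX_le:
  fixes n :: nat
  assumes n: "0 < n"
  defines "N \<equiv> n choose (n div 2)"
  shows "real (sX n) \<le> (real n + 1) * ((real n ^ 2) powr (32 * real N / real n ^ 2 + 1)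
           * exp (real N / real n ^ 2))"
proof -
  let ?E = "{1..n}" and ?b = "32 * real N / real n ^ 2 + 1" and ?V = "\<lambda>r. {X. X \<subseteq> {1..n} \<and> card X = r}"
  \<comment> \<open>Rounding down loses no family, since cardinalities are integers.\<close>
  define q where "q = nat \<lfloor>?b\<rfloor>"
  define B where "B = (real n ^ 2) powr ?b * exp (real N / real n ^ 2)"
  have b: "0 \<le> ?b" by (simp add: add_increasing)
  have n2: "1 \<le> real n ^ 2" using n by (simp add: one_le_power)
  let ?S = "\<lambda>r. paving_indep ?E r ` {J. J \<subseteq> ?V r \<and> card J \<le> q}"
  have cS: "real (card (?S r)) \<le> B" for r
  proof -
    have "card (?S r) \<le> card {J. J \<subseteq> ?V r \<and> card J \<le> q}" by (intro card_image_le) simp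
    also have "real \<dots> \<le> (real n ^ 2) ^ q * exp (real (card (?V r)) / real n ^ 2)"
      by (intro card_small_subsets_le n2) simp
    also have "\<dots> \<le> B" unfolding B_def
    proof (intro mult_mono)
      have "(real n ^ 2) ^ q = (real n ^ 2) powr real q" using n by (simp add: powr_realpow)
      also have "\<dots> \<le> (real n ^ 2) powr ?b"
        using n2 b unfolding q_def by (intro powr_mono) (auto simp: of_nat_nat)
      finally show "(real n ^ 2) ^ q \<le> (real n ^ 2) powr ?b" .
      have "card (?V r) \<le> N" unfolding N_def by (simp add: n_subsets binomial_maximum)
      then show "exp (real (card (?V r)) / real n ^ 2) \<le> exp (real N / real n ^ 2)"
        by (simp add: divide_right_mono)
    qed auto
    finally show ?thesis by simp
  qed
  have "{Ind. matroid ?E Ind \<and> sparse_paving ?E Ind \<and> \<not> has_minor_iso ?E Ind six whirl3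
      \<and> \<not> has_minor_iso ?E Ind six MK4} \<subseteq> (\<Union>r\<in>{..n}. ?S r)"
  proof clarify
    fix Ind assume M: "matroid ?E Ind" "sparse_paving ?E Ind"
      and no: "\<not> has_minor_iso ?E Ind six whirl3" "\<not> has_minor_iso ?E Ind six MK4"
    define r where "r = mrank Ind ?E"
    define I where "I = {X. X \<subseteq> ?E \<and> card X = r \<and> X \<notin> Ind}"
    have st: "johnson_stable ?E r I" and Ind: "Ind = paving_indep ?E r I"
      using sparse_paving_imp_johnson_stable[OF M] unfolding r_def I_def by auto
    have "{} \<in> Ind" using M unfolding matroid_def by blast
    then obtain Y where "Y \<subseteq> ?E" "card Y = r"
      using mrank_attained[of ?E Ind] unfolding r_def by (metis finite_atLeastAtMost)
    then have r: "r \<le> n" using card_mono[of ?E Y] by simp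
    have "\<not> has_minor_iso ?E (paving_indep ?E r I) six whirl3"
      "\<not> has_minor_iso ?E (paving_indep ?E r I) six MK4"
      using no unfolding Ind[symmetric] by blast+
    then have "real (card I) \<le> ?b"
      unfolding N_def using n r st by (intro card_nonbases_le[of ?E]) simp_all
    then have "card I \<le> q" unfolding q_def by (rule le_nat_floor)
    moreover have "I \<subseteq> ?V r" unfolding I_def by auto
    ultimately show "Ind \<in> (\<Union>r\<in>{..n}. ?S r)" using r Ind by blast
  qed
  then have "sX n \<le> card (\<Union>r\<in>{..n}. ?S r)" unfolding sX_def by (intro card_mono) auto
  also have "\<dots> \<le> (\<Sum>r\<in>{..n}. card (?S r))" by (intro card_UN_le) simp
  also have "real \<dots> \<le> (\<Sum>r\<in>{..n}. B)" unfolding of_nat_sum by (intro sum_mono cS)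
  also have "\<dots> = (real n + 1) * B" by simp
  finally show ?thesis unfolding B_def by simp
qed

section \<open>Lower bound for \<open>s\<close>\<close>

text \<open>The Graham--Sloane construction: the \<open>r\<close>-subsets whose elements have a prescribed sum
  modulo \<open>n\<close> are pairwise nonadjacent in the Johnson graph.\<close>

lemma exists_large_johnson_stable:
  assumes n: "0 < n"
  obtains I where "johnson_stable {1..n} r I" "n choose r \<le> card I * n"
proof -
  let ?V = "{X. X \<subseteq> {1..n} \<and> card X = r}"
  \<comment> \<open>Some residue of the element sum is shared by at least a fraction
    \<open>1 / n\<close> of all \<open>r\<close>-subsets.\<close>
  have "\<exists>y\<in>{..<n}. card ((\<lambda>X. \<Sum>X mod n) -` {y} \<inter> ?V) * card {..<n} \<ge> card ?V"
    using n by (intro pigeonhole_card) auto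
  then obtain y where y: "card ((\<lambda>X. \<Sum>X mod n) -` {y} \<inter> ?V) * n \<ge> card ?V" by auto
  define I where "I = (\<lambda>X. \<Sum>X mod n) -` {y} \<inter> ?V"
  have "johnson_stable {1..n} r I"
    unfolding johnson_stable_def
  proof (intro conjI ballI impI)
    fix X Z assume XZ: "X \<in> I" "Z \<in> I" "X \<noteq> Z"
    then have X: "X \<subseteq> {1..n}" "card X = r" "finite X" and Z: "Z \<subseteq> {1..n}" "card Z = r" "finite Z"
      unfolding I_def by (auto intro: finite_subset)
    show "Suc (card (X \<inter> Z)) < r"
    proof (rule ccontr)
      assume "\<not> Suc (card (X \<inter> Z)) < r"
      moreover have "X \<inter> Z \<noteq> X" using XZ(3) X Z card_subset_eq[of Z X] by auto
      then have "card (X \<inter> Z) < r" using X by (metis inf_le1 psubsetI psubset_card_mono)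
      ultimately have c: "Suc (card (X \<inter> Z)) = r" by simp
      obtain z x where xz: "z \<in> Z" "x \<in> X - Z" "X = insert x (Z - {z})"
        using johnson_neighbour[OF Z(3) X(3) Z(2) X(2) c] .
      \<comment> \<open>Adjacent sets differ by exchanging \<open>z\<close> for \<open>x\<close>, so
        equal sums modulo \<open>n\<close> make \<open>x\<close> and \<open>z\<close>
        congruent.\<close>
      have "\<Sum>X = x + \<Sum>(Z - {z})" using xz Z by simp
      moreover have "\<Sum>Z = z + \<Sum>(Z - {z})" using xz Z by (simp add: sum.remove)
      ultimately have "(x + \<Sum>(Z - {z})) mod n = (z + \<Sum>(Z - {z})) mod n"
        using XZ unfolding I_def by simp
      then have "[x = z] (mod n)" unfolding Cong.cong_def[symmetric] by (simp add: cong_add_rcancel_nat)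
      moreover have "1 \<le> x" "x \<le> n" "1 \<le> z" "z \<le> n" using xz X Z by auto
      \<comment> \<open>The elements \<open>1\<close> to \<open>n\<close> have distinct residues,
        but \<open>n\<close> has residue 0 and is split off.\<close>
      ultimately have "x = z" unfolding Cong.cong_def
        by (cases "x = n"; cases "z = n") auto
      then show False using xz by blast
    qed
  qed (auto simp: I_def)
  moreover have "n choose r \<le> card I * n" using y unfolding I_def by (simp add: n_subsets)
  ultimately show ?thesis using that by blast
qed

text \<open>Subsets of a stable set are stable, so one large stable set \<open>I\<close> yields
  \<open>2 ^ card I\<close> sparse paving matroids. They are distinct because the nonbases can be
  read off from the independent sets.\<close>

lemma s_ge:
  fixes n :: nat
  assumes n: "2 \<le> n"
  defines "N \<equiv> n choose (n div 2)"
  shows "2 powr (real N / real n) \<le> real (s n)"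
proof -
  define r where "r = n div 2"
  have r: "0 < r" "r < n" using n unfolding r_def by auto
  obtain I where st: "johnson_stable {1..n} r I" and N: "N \<le> card I * n"
    using exists_large_johnson_stable[of n r] n unfolding N_def r_def by auto
  have IV: "I \<subseteq> {X. X \<subseteq> {1..n} \<and> card X = r}"
    using st by (rule johnson_stable_layer)
  then have fI: "finite I" by (rule finite_subset) simp
  have stJ: "johnson_stable {1..n} r J" if "J \<subseteq> I" for J
    using st that unfolding johnson_stable_def by (meson order_trans subsetD)
  have "inj_on (paving_indep {1..n} r) (Pow I)"
  proof (rule inj_onI)
    have *: "J = {X. X \<subseteq> {1..n} \<and> card X = r \<and> X \<notin> paving_indep {1..n} r J}" if "J \<in> Pow I" for J
      using that IV unfolding paving_indep_def by auto
    fix J K assume "J \<in> Pow I" "K \<in> Pow I" "paving_indep {1..n} r J = paving_indep {1..n} r K"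
    then show "J = K" using *[of J] *[of K] by simp
  qed
  moreover have "paving_indep {1..n} r ` Pow I \<subseteq> {Ind. matroid {1..n} Ind \<and> sparse_paving {1..n} Ind}"
    using paving_indep_sparse_paving[OF _ _ _ stJ] r by auto
  moreover have "finite {Ind. matroid {1..n} Ind \<and> sparse_paving {1..n} Ind}"
    by (rule finite_subset[of _ "Pow (Pow {1..n})"]) (auto simp: matroid_def)
  ultimately have "card (Pow I) \<le> s n" unfolding s_def by (rule card_inj_on_le)
  then have "2 ^ card I \<le> s n" using fI by (simp add: card_Pow)
  then have le: "(2::real) ^ card I \<le> real (s n)" by (metis of_nat_le_iff of_nat_numeral of_nat_power)
  have "real N \<le> real (card I) * real n" using N by (metis of_nat_le_iff of_nat_mult)
  then have "real N / real n \<le> real (card I)" using n by (simp add: field_simps)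
  then have "(2::real) powr (real N / real n) \<le> 2 powr real (card I)" by (intro powr_mono) auto
  also have "\<dots> = 2 ^ card I" by (simp add: powr_realpow)
  finally show ?thesis using le by linarith
qed

section \<open>Asymptotic comparison\<close>

theorem theorem7:
  shows "(\<lambda>n. real (sX n)) \<in> o(\<lambda>n. real (s n))"
proof -
  define N where "N = (\<lambda>n::nat. real (n choose (n div 2)))"
  \<comment> \<open>\<open>h\<close> will bound the ratio: \<open>n + 1\<close> counts ranks,
    \<open>n ^ 2\<close> comes from the summand \<open>1\<close> in the bound on nonbases, and the
    exponential from \<open>gap\<close> together with \<open>M \<ge> 1 / 4\<close>.\<close>
  define h where "h = (\<lambda>n::nat. (real n + 1) * real n ^ 2 * exp (- real n / 8))"
  \<comment> \<open>\<open>2 / 3\<close> is a rational lower bound for \<open>ln 2\<close>, still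
    above \<open>1 / 2\<close>. The term \<open>64 * ln n\<close> is \<open>32 * ln (n^2)\<close>,
    and the final \<open>1\<close> accounts for \<open>exp (N / n^2)\<close>.\<close>
  have "\<forall>\<^sub>F n in sequentially. real n * (2 / 3) - 64 * ln (real n) - 1 \<ge> real n / 2"
    by real_asymp
  then have gap: "\<forall>\<^sub>F n in sequentially. real n * ln 2 - 64 * ln (real n) - 1 \<ge> real n / 2"
  proof eventually_elim
    case (elim n)
    have "real n * (2 / 3) \<le> real n * ln 2"
      using ln2_ge_two_thirds by (intro mult_left_mono) auto
    with elim show ?case by linarith
  qed
  have bound: "\<forall>\<^sub>F n in sequentially. norm (real (sX n)) \<le> h n * norm (real (s n))"
    using gap eventually_ge_at_top[of 2]
  proof eventually_elim
    case (elim n)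
    \<comment> \<open>With this scale \<open>N / n\<close> becomes \<open>M * n\<close>, so the main
      terms of both exponents are multiples of \<open>M\<close>.\<close>
    define M where "M = N n / real n ^ 2"
    have n: "0 < real n" using elim by simp
    \<comment> \<open>A constant lower bound on \<open>M\<close> suffices, and
      \<open>n choose 2\<close> is at least \<open>n^2 / 4\<close> once
      \<open>n \<ge> 2\<close>.\<close>
    have "n choose 2 \<le> n choose (n div 2)" by (rule binomial_maximum)
    then have "real (n choose 2) \<le> N n" unfolding N_def by simp
    moreover have "2 * (n choose 2) = n * (n - 1)" by (cases "even n") (auto simp: choose_two)
    then have "2 * real (n choose 2) = real (n * (n - 1))" by (metis of_nat_mult of_nat_numeral)
    then have "real (n choose 2) = real n * (real n - 1) / 2" using elim by (simp add: of_nat_diff)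
    moreover have "real n ^ 2 / 4 \<le> real n * (real n - 1) / 2"
      using elim by (simp add: power2_eq_square field_simps)
    ultimately have M: "1 / 4 \<le> M" using n by (simp add: M_def field_simps)
    have "M * (real n / 2) \<ge> 1 / 4 * (real n / 2)" using M n by (intro mult_right_mono) auto
    moreover have "M * (real n * ln 2 - 64 * ln (real n) - 1) \<ge> M * (real n / 2)"
    proof (rule mult_left_mono)
      show "0 \<le> M" using M by linarith
    qed (use elim in simp)
    ultimately have key: "64 * M * ln (real n) + M \<le> M * real n * ln 2 - real n / 8"
      by (simp add: algebra_simps)
    have "(real n ^ 2) powr (32 * M + 1) * exp M = real n ^ 2 * exp (64 * M * ln (real n) + M)"
      using n by (simp add: powr_def exp_add ln_realpow algebra_simps)
        (simp add: exp_double)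
    also have "\<dots> \<le> real n ^ 2 * exp (M * real n * ln 2 - real n / 8)"
      using key by (intro mult_left_mono) auto
    also have "\<dots> = real n ^ 2 * exp (- real n / 8) * 2 powr (N n / real n)"
    proof -
      have "M * real n = N n / real n" using n by (simp add: M_def power2_eq_square)
      then have "exp (M * real n * ln 2 - real n / 8) = exp (- real n / 8 + N n / real n * ln 2)"
        by simp
      also have "\<dots> = exp (- real n / 8) * 2 powr (N n / real n)"
        unfolding exp_add by (simp add: powr_def)
      finally show ?thesis by (simp only: mult.assoc)
    qed
    also have "\<dots> \<le> real n ^ 2 * exp (- real n / 8) * real (s n)"
      using s_ge[of n] elim unfolding N_def by (intro mult_left_mono) auto
    finally have "(real n + 1) * ((real n ^ 2) powr (32 * M + 1) * exp M)
        \<le> (real n + 1) * (real n ^ 2 * exp (- real n / 8) * real (s n))"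
      by (intro mult_left_mono) auto
    also have "\<dots> = h n * norm (real (s n))" by (simp add: h_def)
    finally have "(real n + 1) * ((real n ^ 2) powr (32 * M + 1) * exp M) \<le> h n * norm (real (s n))" .
    moreover have "real (sX n) \<le> (real n + 1) * ((real n ^ 2) powr (32 * M + 1) * exp M)"
      using sX_le[of n] elim unfolding M_def N_def by simp
    ultimately show ?case by simp
  qed
  show ?thesis
  proof (rule landau_o.smallI)
    fix c :: real assume "c > 0"
    have "h \<longlonglongrightarrow> 0" unfolding h_def by real_asymp
    then have "\<forall>\<^sub>F n in sequentially. h n < c" using \<open>c > 0\<close> by (rule order_tendstoD)
    then show "\<forall>\<^sub>F n in sequentially. norm (real (sX n)) \<le> c * norm (real (s n))"
      using bound
    proof eventually_elim
      case (elim n)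
      have "h n * norm (real (s n)) \<le> c * norm (real (s n))"
        using elim by (intro mult_right_mono) auto
      then show ?case using elim by simp
    qed
  qed
qed

end
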